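(* Let $D$ be a Dedekind domain, let $S$ be a nonempty subset of $D$, let $h\in\mathbb{N}\cup\{+\infty\}$ and $r\in\mathbb{N}$, and let $\mathcal{T}_1\subseteq\mathcal{T}_2\subseteq\mathscr{I}(D)$, where $\mathscr{I}(D)$ is the set of all ideals of $D$. Then for integers $0\le k<|S|$, $$[k]!_{S,\mathcal{T}_1}^{h,\{r\}}\quad\text{divides}\quad[k]!_{S,\mathcal{T}_2}^{h,\{r\}}.$$ Equivalently, $[k]!_{S,\mathcal{T}_2}^{h,\{r\}}$ is contained in $[k]!_{S,\mathcal{T}_1}^{h,\{r\}}$.
   Context: $\mathbb{N}=\{0,1,2,\dots\}$. For an ideal $\mathfrak{b}$ of $D$, with $\mathfrak{b}^0=D$, put $v_{\mathfrak{b}}(a)=\sup\{k\in\mathbb{N}: aD\subseteq\mathfrak{b}^k\}\in\mathbb{N}\cup\{+\infty\}$ for $a\in D$. For a sequence $\mathbf{a}=(a_i)_{i=0}^\infty$ of elements of $S$ (repetitions allowed) define $$\alpha_n^{h,\{r\}}(S,\mathfrak{b},\mathbf{a})=\min_{A}\sum_{i\in A}\min\bigl(h,v_{\mathfrak{b}}(a_n-a_i)\bigr),$$ where $A$ ranges over all subsets of $\{0,\dots,n-1\}$ of cardinality $\max(n-r,0)$ (so the value is $0$ for $0\le n\le r$). The sequence $\mathbf{a}$ is an $r$-removed $\mathfrak{b}$-ordering of order $h$ of $S$ if $a_0,\dots,a_r\in S$ are arbitrary and, for every $n>r$, $a_n$ attains the minimum over $s\in S$ of $\min_{A}\sum_{i\in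 A}\min(h,v_{\mathfrak{b}}(s-a_i))$, $A$ ranging over subsets of $\{0,\dots,n-1\}$ of cardinality $n-r$. In a Dedekind domain, the numbers $\alpha_n^{h,\{r\}}(S,\mathfrak{b},\mathbf{a})$ are the same for all $r$-removed $\mathfrak{b}$-orderings $\mathbf{a}$ of order $h$ of $S$; the common value is denoted $\alpha_n^{h,\{r\}}(S,\mathfrak{b})$. For $\mathcal{T}\subseteq\mathscr{I}(D)$ the $k$-th generalized factorial ideal is $$[k]!_{S,\mathcal{T}}^{h,\{r\}}=\prod_{\mathfrak{b}\in\mathcal{T}}\mathfrak{b}^{\alpha_k^{h,\{r\}}(S,\mathfrak{b})},$$ with conventions $\mathfrak{b}^0=(1)$ (including $(0)^0=(1)$), $\mathfrak{b}^{+\infty}=(0)$ for $\mathfrak{b}\neq(1)$, every power of $(1)$ equal to $(1)$, and the empty product equal to $(1)$. For $k<|S|$ only finitely many factors differ from the unit ideal $(1)=D$. *)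

theory Defs
  imports "HOL-Algebra.Algebra" "HOL-Library.Extended_Nat"
begin

section \<open>Dedekind domains\<close>

definition frac_rel :: "('a, 'm) ring_scheme \<Rightarrow> (('a \<times> 'a) \<times> ('a \<times> 'a)) set" where
  "frac_rel R = {((a, b), (c, d)).
      a \<in> carrier R \<and> b \<in> carrier R - {\<zero>\<^bsub>R\<^esub>} \<and> c \<in> carrier R \<and> d \<in> carrier R - {\<zero>\<^bsub>R\<^esub>} \<and>
      a \<otimes>\<^bsub>R\<^esub> d = c \<otimes>\<^bsub>R\<^esub> b}"

definition frac_class :: "('a, 'm) ring_scheme \<Rightarrow> 'a \<Rightarrow> 'a \<Rightarrow> ('a \<times> 'a) set" where
  "frac_class R a b = frac_rel R `` {(a, b)}"

text \<open>The operations are well defined on classes, so each union below is a union of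
  equal classes.\<close>

definition fraction_field :: "('a, 'm) ring_scheme \<Rightarrow> ('a \<times> 'a) set ring" where
  "fraction_field R =
    \<lparr> carrier = (carrier R \<times> (carrier R - {\<zero>\<^bsub>R\<^esub>})) // frac_rel R,
      monoid.mult = (\<lambda>U V. \<Union>(a, b)\<in>U. \<Union>(c, d)\<in>V. frac_class R (a \<otimes>\<^bsub>R\<^esub> c) (b \<otimes>\<^bsub>R\<^esub> d)),
      one = frac_class R \<one>\<^bsub>R\<^esub> \<one>\<^bsub>R\<^esub>,
      ring.zero = frac_class R \<zero>\<^bsub>R\<^esub> \<one>\<^bsub>R\<^esub>,
      add = (\<lambda>U V. \<Union>(a, b)\<in>U. \<Union>(c, d)\<in>V.
              frac_class R ((a \<otimes>\<^bsub>R\<^esub> d) \<oplus>\<^bsub>R\<^esub> (c \<otimes>\<^bsub>R\<^esub> b)) (b \<otimes>\<^bsub>R\<^esub> d)) \<rparr>"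

definition frac_embed :: "('a, 'm) ring_scheme \<Rightarrow> 'a \<Rightarrow> ('a \<times> 'a) set" where
  "frac_embed R a = frac_class R a \<one>\<^bsub>R\<^esub>"


context domain
begin

lemma equiv_frac_rel:
  "equiv (carrier R \<times> (carrier R - {\<zero>})) (frac_rel R)"
proof (rule equivI)
  show "frac_rel R \<subseteq> (carrier R \<times> (carrier R - {\<zero>})) \<times> (carrier R \<times> (carrier R - {\<zero>}))"
    by (auto simp: frac_rel_def)
  show "refl_on (carrier R \<times> (carrier R - {\<zero>})) (frac_rel R)"
    by (auto simp: frac_rel_def refl_on_def)
  show "sym (frac_rel R)"
    by (auto simp: frac_rel_def sym_def)
  show "trans (frac_rel R)"
  proof (rule transI, clarsimp simp: frac_rel_def)
    fix a b c d e f
    assume A: "a \<in> carrier R" "b \<in> carrier R" "c \<in> carrier R" "d \<in> carrier R"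
        "e \<in> carrier R" "f \<in> carrier R" "d \<noteq> \<zero>"
      and 1: "a \<otimes> d = c \<otimes> b" and 2: "c \<otimes> f = e \<otimes> d"
    have "d \<otimes> (a \<otimes> f) = (a \<otimes> d) \<otimes> f" using A by (simp add: m_ac)
    also have "\<dots> = (c \<otimes> f) \<otimes> b" using A 1 by (simp add: m_ac)
    also have "\<dots> = d \<otimes> (e \<otimes> b)" using A 2 by (simp add: m_ac)
    finally show "a \<otimes> f = e \<otimes> b" using A by (simp add: m_lcancel)
  qed
qed

lemma frac_class_eq_iff:
  assumes "a \<in> carrier R" "b \<in> carrier R - {\<zero>}" "c \<in> carrier R" "d \<in> carrier R - {\<zero>}"
  shows "frac_class R a b = frac_class R c d \<longleftrightarrow> a \<otimes> d = c \<otimes> b"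
proof -
  have "frac_class R a b = frac_class R c d \<longleftrightarrow> ((a, b), (c, d)) \<in> frac_rel R"
    unfolding frac_class_def using assms by (intro eq_equiv_class_iff[OF equiv_frac_rel]) auto
  then show ?thesis using assms by (simp add: frac_rel_def)
qed

lemma frac_class_cases:
  assumes "U \<in> carrier (fraction_field R)"
  obtains a b where "a \<in> carrier R" "b \<in> carrier R" "b \<noteq> \<zero>" "U = frac_class R a b"
  using assms unfolding fraction_field_def frac_class_def by (auto elim!: quotientE)

lemma frac_class_closed:
  assumes "a \<in> carrier R" "b \<in> carrier R" "b \<noteq> \<zero>"
  shows "frac_class R a b \<in> carrier (fraction_field R)"
  using assms unfolding fraction_field_def frac_class_def by (auto intro: quotientI)

lemma frac_class_mem:
  assumes "a \<in> carrier R" "b \<in> carrier R" "b \<noteq> \<zero>"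
  shows "(x, y) \<in> frac_class R a b \<longleftrightarrow>
    x \<in> carrier R \<and> y \<in> carrier R \<and> y \<noteq> \<zero> \<and> a \<otimes> y = x \<otimes> b"
  using assms by (auto simp: frac_class_def frac_rel_def)

lemma frac_UN_eq:
  assumes "a \<in> carrier R" "b \<in> carrier R" "b \<noteq> \<zero>" "c \<in> carrier R" "d \<in> carrier R" "d \<noteq> \<zero>"
    and "\<And>a' b' c' d'. \<lbrakk>(a', b') \<in> frac_class R a b; (c', d') \<in> frac_class R c d\<rbrakk> \<Longrightarrow>
      F a' b' c' d' = F a b c d"
  shows "(\<Union>(a', b') \<in> frac_class R a b. \<Union>(c', d') \<in> frac_class R c d. F a' b' c' d') = F a b c d"
proof -
  have "(a, b) \<in> frac_class R a b" "(c, d) \<in> frac_class R c d"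
    using assms(1-6) by (simp_all add: frac_class_mem)
  then show ?thesis using assms(7) by blast
qed

lemma frac_mult:
  assumes A: "a \<in> carrier R" "b \<in> carrier R" "b \<noteq> \<zero>" "c \<in> carrier R" "d \<in> carrier R" "d \<noteq> \<zero>"
  shows "frac_class R a b \<otimes>\<^bsub>fraction_field R\<^esub> frac_class R c d = frac_class R (a \<otimes> c) (b \<otimes> d)"
  unfolding fraction_field_def monoid.simps
proof (subst frac_UN_eq[OF A, where F = "\<lambda>a b c d. frac_class R (a \<otimes> c) (b \<otimes> d)"])
  fix a' b' c' d'
  assume *: "(a', b') \<in> frac_class R a b" "(c', d') \<in> frac_class R c d"
  then have B: "a' \<in> carrier R" "b' \<in> carrier R" "b' \<noteq> \<zero>" "c' \<in> carrier R" "d' \<in> carrier R" "d' \<noteq> \<zero>"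
    and 1: "a \<otimes> b' = a' \<otimes> b" and 2: "c \<otimes> d' = c' \<otimes> d"
    using A by (simp_all add: frac_class_mem)
  have "(a' \<otimes> c') \<otimes> (b \<otimes> d) = (a' \<otimes> b) \<otimes> (c' \<otimes> d)" using A B by (simp add: m_ac)
  also have "\<dots> = (a \<otimes> b') \<otimes> (c \<otimes> d')" using 1 2 by simp
  also have "\<dots> = (a \<otimes> c) \<otimes> (b' \<otimes> d')" using A B by (simp add: m_ac)
  finally show "frac_class R (a' \<otimes> c') (b' \<otimes> d') = frac_class R (a \<otimes> c) (b \<otimes> d)"
    using A B by (subst frac_class_eq_iff) (auto simp: integral_iff)
qed simp

lemma frac_add:
  assumes A: "a \<in> carrier R" "b \<in> carrier R" "b \<noteq> \<zero>" "c \<in> carrier R" "d \<in> carrier R" "d \<noteq> \<zero>"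
  shows "frac_class R a b \<oplus>\<^bsub>fraction_field R\<^esub> frac_class R c d =
    frac_class R ((a \<otimes> d) \<oplus> (c \<otimes> b)) (b \<otimes> d)"
  unfolding fraction_field_def ring_record_simps
proof (subst frac_UN_eq[OF A, where F = "\<lambda>a b c d. frac_class R ((a \<otimes> d) \<oplus> (c \<otimes> b)) (b \<otimes> d)"])
  fix a' b' c' d'
  assume *: "(a', b') \<in> frac_class R a b" "(c', d') \<in> frac_class R c d"
  then have B: "a' \<in> carrier R" "b' \<in> carrier R" "b' \<noteq> \<zero>" "c' \<in> carrier R" "d' \<in> carrier R" "d' \<noteq> \<zero>"
    and 1: "a \<otimes> b' = a' \<otimes> b" and 2: "c \<otimes> d' = c' \<otimes> d"
    using A by (simp_all add: frac_class_mem)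
  have "((a' \<otimes> d') \<oplus> (c' \<otimes> b')) \<otimes> (b \<otimes> d) =
      ((a' \<otimes> d') \<otimes> (b \<otimes> d)) \<oplus> ((c' \<otimes> b') \<otimes> (b \<otimes> d))"
    using A B by (intro l_distr) auto
  also have "(a' \<otimes> d') \<otimes> (b \<otimes> d) = (a' \<otimes> b) \<otimes> (d' \<otimes> d)" using A B by (simp add: m_ac)
  also have "(c' \<otimes> b') \<otimes> (b \<otimes> d) = (c' \<otimes> d) \<otimes> (b' \<otimes> b)" using A B by (simp add: m_ac)
  also have "a' \<otimes> b = a \<otimes> b'" by (rule 1[symmetric])
  also have "c' \<otimes> d = c \<otimes> d'" by (rule 2[symmetric])
  also have "(a \<otimes> b') \<otimes> (d' \<otimes> d) = (a \<otimes> d) \<otimes> (b' \<otimes> d')" using A B by (simp add: m_ac)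
  also have "(c \<otimes> d') \<otimes> (b' \<otimes> b) = (c \<otimes> b) \<otimes> (b' \<otimes> d')" using A B by (simp add: m_ac)
  also have "((a \<otimes> d) \<otimes> (b' \<otimes> d')) \<oplus> ((c \<otimes> b) \<otimes> (b' \<otimes> d')) =
      ((a \<otimes> d) \<oplus> (c \<otimes> b)) \<otimes> (b' \<otimes> d')"
    using A B by (intro l_distr[symmetric]) auto
  finally show "frac_class R ((a' \<otimes> d') \<oplus> (c' \<otimes> b')) (b' \<otimes> d') =
      frac_class R ((a \<otimes> d) \<oplus> (c \<otimes> b)) (b \<otimes> d)"
    using A B by (subst frac_class_eq_iff) (auto simp: integral_iff)
qed simp

lemma frac_one: "\<one>\<^bsub>fraction_field R\<^esub> = frac_class R \<one> \<one>"
  and frac_zero: "\<zero>\<^bsub>fraction_field R\<^esub> = frac_class R \<zero> \<one>"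
  by (simp_all add: fraction_field_def)

lemma frac_cancel:
  assumes "a \<in> carrier R" "b \<in> carrier R" "b \<noteq> \<zero>" "x \<in> carrier R" "x \<noteq> \<zero>"
  shows "frac_class R (a \<otimes> x) (b \<otimes> x) = frac_class R a b"
  using assms by (subst frac_class_eq_iff) (auto simp: integral_iff m_ac)

lemma frac_add_same:
  assumes "a \<in> carrier R" "b \<in> carrier R" "b \<noteq> \<zero>" "c \<in> carrier R"
  shows "frac_class R a b \<oplus>\<^bsub>fraction_field R\<^esub> frac_class R c b = frac_class R (a \<oplus> c) b"
  using assms by (simp add: frac_add frac_cancel flip: l_distr)

lemma frac_common2:
  assumes "U \<in> carrier (fraction_field R)" "V \<in> carrier (fraction_field R)"
  obtains a b n where "a \<in> carrier R" "b \<in> carrier R" "n \<in> carrier R" "n \<noteq> \<zero>"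
    "U = frac_class R a n" "V = frac_class R b n"
proof -
  obtain a m where U: "a \<in> carrier R" "m \<in> carrier R" "m \<noteq> \<zero>" "U = frac_class R a m"
    using assms(1) by (rule frac_class_cases)
  obtain b n where V: "b \<in> carrier R" "n \<in> carrier R" "n \<noteq> \<zero>" "V = frac_class R b n"
    using assms(2) by (rule frac_class_cases)
  show thesis
  proof (rule that[of "a \<otimes> n" "b \<otimes> m" "m \<otimes> n"])
    show "V = frac_class R (b \<otimes> m) (m \<otimes> n)"
      using U V frac_cancel[of b n m] by (simp add: m_comm)
  qed (use U V in \<open>simp_all add: integral_iff frac_cancel\<close>)
qed

lemma frac_common3:
  assumes "U \<in> carrier (fraction_field R)" "V \<in> carrier (fraction_field R)"
    "W \<in> carrier (fraction_field R)"
  obtains a b c n where "a \<in> carrier R" "b \<in> carrier R" "c \<in> carrier R" "n \<in> carrier R" "n \<noteq> \<zero>"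
    "U = frac_class R a n" "V = frac_class R b n" "W = frac_class R c n"
proof -
  obtain a b m where U: "a \<in> carrier R" "b \<in> carrier R" "m \<in> carrier R" "m \<noteq> \<zero>"
      "U = frac_class R a m" "V = frac_class R b m"
    using assms(1,2) by (rule frac_common2)
  obtain c n where W: "c \<in> carrier R" "n \<in> carrier R" "n \<noteq> \<zero>" "W = frac_class R c n"
    using assms(3) by (rule frac_class_cases)
  show thesis
  proof (rule that[of "a \<otimes> n" "b \<otimes> n" "c \<otimes> m" "m \<otimes> n"])
    show "W = frac_class R (c \<otimes> m) (m \<otimes> n)"
      using U W frac_cancel[of c n m] by (simp add: m_comm)
  qed (use U W in \<open>simp_all add: integral_iff frac_cancel\<close>)
qed

lemma field_fraction_field: "field (fraction_field R)"
proof -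
  let ?F = "fraction_field R"
  have ab: "abelian_group ?F"
  proof (rule abelian_groupI)
    fix U V W assume *: "U \<in> carrier ?F" "V \<in> carrier ?F" "W \<in> carrier ?F"
    from * obtain a b c n where "a \<in> carrier R" "b \<in> carrier R" "c \<in> carrier R"
        "n \<in> carrier R" "n \<noteq> \<zero>"
        "U = frac_class R a n" "V = frac_class R b n" "W = frac_class R c n"
      by (rule frac_common3)
    then show "U \<oplus>\<^bsub>?F\<^esub> V \<oplus>\<^bsub>?F\<^esub> W = U \<oplus>\<^bsub>?F\<^esub> (V \<oplus>\<^bsub>?F\<^esub> W)"
      by (simp add: frac_add_same a_assoc)
  next
    fix U V assume *: "U \<in> carrier ?F" "V \<in> carrier ?F"
    from * obtain a b n where E: "a \<in> carrier R" "b \<in> carrier R" "n \<in> carrier R" "n \<noteq> \<zero>"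
        "U = frac_class R a n" "V = frac_class R b n"
      by (rule frac_common2)
    then show "U \<oplus>\<^bsub>?F\<^esub> V \<in> carrier ?F"
      by (simp add: frac_add_same frac_class_closed)
    from E show "U \<oplus>\<^bsub>?F\<^esub> V = V \<oplus>\<^bsub>?F\<^esub> U"
      by (simp add: frac_add_same a_comm)
  next
    show "\<zero>\<^bsub>?F\<^esub> \<in> carrier ?F"
      by (simp add: frac_zero frac_class_closed)
  next
    fix U assume "U \<in> carrier ?F"
    then obtain a b where U: "a \<in> carrier R" "b \<in> carrier R" "b \<noteq> \<zero>" "U = frac_class R a b"
      by (rule frac_class_cases)
    then show "\<zero>\<^bsub>?F\<^esub> \<oplus>\<^bsub>?F\<^esub> U = U"
      by (simp add: frac_zero frac_add)
    from U have "frac_class R (\<ominus> a) b \<oplus>\<^bsub>?F\<^esub> U = \<zero>\<^bsub>?F\<^esub>"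
      by (simp add: frac_add_same l_neg frac_zero frac_class_eq_iff)
    with U show "\<exists>V\<in>carrier ?F. V \<oplus>\<^bsub>?F\<^esub> U = \<zero>\<^bsub>?F\<^esub>"
      by (meson a_inv_closed frac_class_closed)
  qed
  have mon: "comm_monoid ?F"
  proof (rule comm_monoidI)
    fix U V W assume *: "U \<in> carrier ?F" "V \<in> carrier ?F" "W \<in> carrier ?F"
    from * obtain a b c n where "a \<in> carrier R" "b \<in> carrier R" "c \<in> carrier R"
        "n \<in> carrier R" "n \<noteq> \<zero>"
        "U = frac_class R a n" "V = frac_class R b n" "W = frac_class R c n"
      by (rule frac_common3)
    then show "U \<otimes>\<^bsub>?F\<^esub> V \<otimes>\<^bsub>?F\<^esub> W = U \<otimes>\<^bsub>?F\<^esub> (V \<otimes>\<^bsub>?F\<^esub> W)"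
      by (simp add: frac_mult integral_iff m_assoc)
  next
    fix U V assume *: "U \<in> carrier ?F" "V \<in> carrier ?F"
    from * obtain a b n where E: "a \<in> carrier R" "b \<in> carrier R" "n \<in> carrier R" "n \<noteq> \<zero>"
        "U = frac_class R a n" "V = frac_class R b n"
      by (rule frac_common2)
    then show "U \<otimes>\<^bsub>?F\<^esub> V \<in> carrier ?F"
      by (simp add: frac_mult integral_iff frac_class_closed)
    from E show "U \<otimes>\<^bsub>?F\<^esub> V = V \<otimes>\<^bsub>?F\<^esub> U"
      by (simp add: frac_mult m_comm)
  next
    show "\<one>\<^bsub>?F\<^esub> \<in> carrier ?F"
      by (simp add: frac_one frac_class_closed)
  next
    fix U assume "U \<in> carrier ?F"
    then obtain a b where U: "a \<in> carrier R" "b \<in> carrier R" "b \<noteq> \<zero>" "U = frac_class R a b"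
      by (rule frac_class_cases)
    then show "\<one>\<^bsub>?F\<^esub> \<otimes>\<^bsub>?F\<^esub> U = U"
      by (simp add: frac_one frac_mult)
  qed
  interpret F: cring ?F
  proof (rule cringI[OF ab mon])
    fix U V W assume *: "U \<in> carrier ?F" "V \<in> carrier ?F" "W \<in> carrier ?F"
    from * obtain a b c n where "a \<in> carrier R" "b \<in> carrier R" "c \<in> carrier R"
        "n \<in> carrier R" "n \<noteq> \<zero>"
        "U = frac_class R a n" "V = frac_class R b n" "W = frac_class R c n"
      by (rule frac_common3)
    then show "(U \<oplus>\<^bsub>?F\<^esub> V) \<otimes>\<^bsub>?F\<^esub> W = U \<otimes>\<^bsub>?F\<^esub> W \<oplus>\<^bsub>?F\<^esub> V \<otimes>\<^bsub>?F\<^esub> W"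
      by (simp add: frac_mult frac_add_same integral_iff l_distr)
  qed
  show ?thesis
  proof (rule F.cring_fieldI2)
    show "\<zero>\<^bsub>?F\<^esub> \<noteq> \<one>\<^bsub>?F\<^esub>"
      by (simp add: frac_zero frac_one frac_class_eq_iff)
    fix U assume "U \<in> carrier ?F" and nz: "U \<noteq> \<zero>\<^bsub>?F\<^esub>"
    from this(1) obtain a b where U: "a \<in> carrier R" "b \<in> carrier R" "b \<noteq> \<zero>" "U = frac_class R a b"
      by (rule frac_class_cases)
    with nz have a: "a \<noteq> \<zero>" by (auto simp: frac_zero frac_class_eq_iff)
    then have "U \<otimes>\<^bsub>?F\<^esub> frac_class R b a = \<one>\<^bsub>?F\<^esub>"
      using U by (simp add: frac_mult frac_one frac_class_eq_iff integral_iff m_comm)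
    then show "\<exists>V\<in>carrier ?F. U \<otimes>\<^bsub>?F\<^esub> V = \<one>\<^bsub>?F\<^esub>"
      using U a by (meson frac_class_closed)
  qed
qed

lemma frac_embed_hom: "frac_embed R \<in> ring_hom R (fraction_field R)"
  by (rule ring_hom_memI)
    (simp_all add: frac_embed_def frac_mult frac_add frac_one frac_class_closed)

lemma inj_frac_embed: "inj_on (frac_embed R) (carrier R)"
  by (rule inj_onI) (simp add: frac_embed_def frac_class_eq_iff)

end

text \<open>Polynomials are coefficient lists with the leading coefficient first.\<close>

definition integral_over ::
  "('k, 'm) ring_scheme \<Rightarrow> 'k set \<Rightarrow> 'k \<Rightarrow> bool" where
  "integral_over L A x \<longleftrightarrow>
    (\<exists>p. p \<noteq> [] \<and> polynomial\<^bsub>L\<^esub> A p \<and> hd p = \<one>\<^bsub>L\<^esub> \<and> ring.eval L p x = \<zero>\<^bsub>L\<^esub>)"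

definition integrally_closed :: "('a, 'm) ring_scheme \<Rightarrow> bool" where
  "integrally_closed R \<longleftrightarrow>
    (\<forall>x \<in> carrier (fraction_field R).
       integral_over (fraction_field R) (frac_embed R ` carrier R) x \<longrightarrow>
       x \<in> frac_embed R ` carrier R)"

text \<open>Fields are included as Dedekind domains.\<close>

locale dedekind_domain = noetherian_domain +
  assumes integrally_closed: "integrally_closed R"
    and nonzero_prime_imp_maximal:
      "\<And>P. primeideal P R \<Longrightarrow> P \<noteq> {\<zero>} \<Longrightarrow> maximalideal P R"


section \<open>Removed orderings with respect to an ideal\<close>

text \<open>\<^const>\<open>ideals_set\<close> is the semiring of ideals under the ideal product, with
  multiplicative unit \<^term>\<open>carrier R\<close>; so its \<open>0\<close>-th powers are \<^term>\<open>carrier R\<close>.\<close>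

definition ideal_val :: "('a, 'm) ring_scheme \<Rightarrow> 'a set \<Rightarrow> 'a \<Rightarrow> enat" where
  "ideal_val R I a = Sup {enat k | k :: nat. PIdl\<^bsub>R\<^esub> a \<subseteq> I [^]\<^bsub>ideals_set R\<^esub> k}"

text \<open>Truncated subtraction makes \<open>n - r\<close> the cardinality \<open>max(n - r, 0)\<close>.\<close>

definition removed_sum ::
  "('a, 'm) ring_scheme \<Rightarrow> 'a set \<Rightarrow> enat \<Rightarrow> nat \<Rightarrow> (nat \<Rightarrow> 'a) \<Rightarrow> nat \<Rightarrow> 'a \<Rightarrow> enat" where
  "removed_sum R I h r a n s =
    Min {\<Sum>i\<in>A. min h (ideal_val R I (s \<ominus>\<^bsub>R\<^esub> a i)) | A. A \<subseteq> {..<n} \<and> card A = n - r}"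

definition removed_ordering ::
  "('a, 'm) ring_scheme \<Rightarrow> 'a set \<Rightarrow> 'a set \<Rightarrow> enat \<Rightarrow> nat \<Rightarrow> (nat \<Rightarrow> 'a) \<Rightarrow> bool" where
  "removed_ordering R S I h r a \<longleftrightarrow>
    (\<forall>n. a n \<in> S) \<and>
    (\<forall>n > r. \<forall>s \<in> S. removed_sum R I h r a n (a n) \<le> removed_sum R I h r a n s)"

definition alpha_seq ::
  "('a, 'm) ring_scheme \<Rightarrow> 'a set \<Rightarrow> enat \<Rightarrow> nat \<Rightarrow> (nat \<Rightarrow> 'a) \<Rightarrow> nat \<Rightarrow> enat" where
  "alpha_seq R I h r a n = removed_sum R I h r a n (a n)"

text \<open>For nonempty \<open>S\<close> an ordering exists, since every nonempty set of extended naturals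
  has a least element. Over a Dedekind domain \<^const>\<open>alpha_seq\<close> takes the same value on
  all orderings, so the choice below is immaterial.\<close>

definition alpha ::
  "('a, 'm) ring_scheme \<Rightarrow> 'a set \<Rightarrow> 'a set \<Rightarrow> enat \<Rightarrow> nat \<Rightarrow> nat \<Rightarrow> enat" where
  "alpha R S I h r n = alpha_seq R I h r (SOME a. removed_ordering R S I h r a) n"


section \<open>Generalized factorial ideals\<close>

definition ideal_epow :: "('a, 'm) ring_scheme \<Rightarrow> 'a set \<Rightarrow> enat \<Rightarrow> 'a set" where
  "ideal_epow R I e =
    (if I = carrier R then carrier R
     else (case e of enat k \<Rightarrow> I [^]\<^bsub>ideals_set R\<^esub> k | \<infinity> \<Rightarrow> {\<zero>\<^bsub>R\<^esub>}))"

text \<open>The product over \<open>T\<close> is the product of its factors different from the unit ideal;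
  there are finitely many of these when \<open>k < |S|\<close>. For an infinite index set
  \<^const>\<open>finprod\<close> would be the unit ideal, a junk value.\<close>

definition factorial_ideal ::
  "('a, 'm) ring_scheme \<Rightarrow> 'a set \<Rightarrow> 'a set set \<Rightarrow> enat \<Rightarrow> nat \<Rightarrow> nat \<Rightarrow> 'a set" where
  "factorial_ideal R S T h r k =
    finprod (ideals_set R) (\<lambda>I. ideal_epow R I (alpha R S I h r k))
      {I \<in> T. ideal_epow R I (alpha R S I h r k) \<noteq> carrier R}"

end

theory Submission
  imports Defs
begin

text \<open>Over the larger family the product has the factors of the smaller one and some more, so
  divisibility is splitting a product over a disjoint union, and containment follows because
  \<open>I J \<subseteq> I\<close>. What has to be proved is that these are finite products: only finitely
  many ideals contribute a factor other than the unit ideal.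

  Choose \<open>k + 1\<close> distinct elements of \<open>S\<close>. If an ideal \<open>I\<close> contains none of their differences,
  then they are pairwise incongruent modulo \<open>I\<close>, so one of them is incongruent to each of the
  \<open>k\<close> earlier terms of a removed ordering. The minimum that defines the exponent of \<open>I\<close> is then
  \<open>0\<close> (\<open>alpha_eq_0\<close>). Hence every contributing ideal contains one of finitely many nonzero
  differences, and it remains to see that a nonzero element \<open>d\<close> of a Dedekind domain lies in only
  finitely many ideals (\<open>finite_ideals_containing\<close>).

  This part of unique factorization is obtained as follows. By Noetherian induction \<open>(d)\<close> contains
  a product of nonzero, hence maximal, prime ideals (\<open>ideal_contains_prime_product\<close>). A nonzero
  maximal ideal \<open>M\<close> is invertible in the sense that \<open>M N = (c)\<close> for some ideal \<open>N\<close> and some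
  \<open>c \<noteq> 0\<close> (\<open>maximalideal_invertible\<close>); this is where integral closure is used. Therefore an ideal
  inside \<open>M\<close> is a multiple of \<open>M\<close>, and \<open>M\<close> can be cancelled. Peeling off one prime after another
  bounds the ideals above the product (\<open>finite_ideals_above_prime_product\<close>).\<close>

section \<open>Noetherian induction on ideals\<close>

lemma (in noetherian_ring) wf_ideal_psupset:
  "wf {(J, I). ideal I R \<and> ideal J R \<and> I \<subset> J}"
  unfolding wf_iff_no_infinite_down_chain
proof
  assume "\<exists>f. \<forall>n. (f (Suc n), f n) \<in> {(J, I). ideal I R \<and> ideal J R \<and> I \<subset> J}"
  then obtain f where "\<forall>n. (f (Suc n), f n) \<in> {(J, I). ideal I R \<and> ideal J R \<and> I \<subset> J}"
    by (rule exE)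
  then have f: "ideal (f n) R" "f n \<subset> f (Suc n)" for n by simp_all
  have "f m \<subseteq> f n" if "m \<le> n" for m n
    using lift_Suc_mono_le[of f, OF psubset_imp_subset[OF f(2)] that] .
  then have "f m \<subseteq> f n \<or> f n \<subseteq> f m" for m n
    using nat_le_linear by blast
  then have "subset.chain {I. ideal I R} (range f)"
    unfolding subset_chain_def using f(1) by blast
  then have "\<Union>(range f) \<in> range f"
    by (intro ideal_chain_is_trivial) auto
  then obtain n where "\<Union>(range f) = f n" by auto
  with f(2)[of n] show False by blast
qed

lemma (in noetherian_ring) ideal_subset_maximalideal:
  assumes "ideal I R" "I \<noteq> carrier R"
  obtains M where "maximalideal M R" "I \<subseteq> M"
proof -
  let ?Q = "{J. ideal J R \<and> I \<subseteq> J \<and> J \<noteq> carrier R}"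
  have "I \<in> ?Q" using assms by auto
  then obtain M where M: "M \<in> ?Q"
    and max: "\<And>J. (J, M) \<in> {(J, I). ideal I R \<and> ideal J R \<and> I \<subset> J} \<Longrightarrow> J \<notin> ?Q"
    by (rule wfE_min[OF wf_ideal_psupset]) (rule that)
  have "maximalideal M R"
  proof (rule maximalidealI)
    fix J assume "ideal J R" "M \<subseteq> J" "J \<subseteq> carrier R"
    then show "J = M \<or> J = carrier R" using M max[of J] by blast
  qed (use M in auto)
  then show thesis using M that by blast
qed

section \<open>Products of ideals\<close>

context ring
begin

lemma ideal_prod_subset_iff:
  assumes "ideal K R"
  shows "I \<cdot> J \<subseteq> K \<longleftrightarrow> (\<forall>i\<in>I. \<forall>j\<in>J. i \<otimes> j \<in> K)"
proof
  assume *: "\<forall>i\<in>I. \<forall>j\<in>J. i \<otimes> j \<in> K"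
  show "I \<cdot> J \<subseteq> K"
  proof
    fix x assume "x \<in> I \<cdot> J"
    then show "x \<in> K"
      by induct (use * assms in \<open>auto intro: additive_subgroup.a_closed ideal.axioms(1)\<close>)
  qed
qed (auto intro: ideal_prod.prod)

lemma ideal_prod_mono:
  assumes "I \<subseteq> I'" "J \<subseteq> J'"
  shows "I \<cdot> J \<subseteq> I' \<cdot> J'"
proof
  fix x assume "x \<in> I \<cdot> J"
  then show "x \<in> I' \<cdot> J'"
    by induct (use assms in \<open>auto intro: ideal_prod.intros\<close>)
qed

end

context cring
begin

text \<open>Multiplication by a principal ideal is dilation by its generator. With this, "multiply
  by \<open>PIdl c\<close>" takes the place of fractional ideals below: an equation
  \<open>M \<cdot> N = PIdl c\<close> says that \<open>M\<close> is invertible with inverse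
  \<open>c\<^sup>-\<^sup>1 N\<close>, and no ideal ever has to leave the ring.\<close>

lemma cgenideal_ideal_prod:
  assumes "c \<in> carrier R" "ideal J R"
  shows "(PIdl c) \<cdot> J = (\<lambda>x. c \<otimes> x) ` J"
proof
  interpret J: ideal J R by fact
  show "(PIdl c) \<cdot> J \<subseteq> (\<lambda>x. c \<otimes> x) ` J"
  proof
    fix x assume "x \<in> (PIdl c) \<cdot> J"
    then show "x \<in> (\<lambda>x. c \<otimes> x) ` J"
    proof induct
      case (prod i j)
      then obtain d where "d \<in> carrier R" "i = d \<otimes> c" unfolding cgenideal_def by auto
      then have "i \<otimes> j = c \<otimes> (d \<otimes> j)" using assms prod by (simp add: m_ac J.Icarr)
      then show ?case using J.I_l_closed[OF prod(2) \<open>d \<in> carrier R\<close>] by blast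
    next
      case (sum s1 s2)
      then obtain x y where "x \<in> J" "y \<in> J" "s1 = c \<otimes> x" "s2 = c \<otimes> y" by auto
      then have "s1 \<oplus> s2 = c \<otimes> (x \<oplus> y)" using assms by (simp add: r_distr J.Icarr)
      then show ?case using J.a_closed[OF \<open>x \<in> J\<close> \<open>y \<in> J\<close>] by blast
    qed
  qed
  show "(\<lambda>x. c \<otimes> x) ` J \<subseteq> (PIdl c) \<cdot> J"
    using assms cgenideal_self by (auto intro: ideal_prod.prod)
qed

lemma ideal_subset_cgenideal_factor:
  assumes c: "c \<in> carrier R" and J: "ideal J R" and sub: "J \<subseteq> PIdl c"
  obtains I where "ideal I R" "J = (PIdl c) \<cdot> I"
proof
  let ?I = "{x \<in> carrier R. c \<otimes> x \<in> J}"
  show I: "ideal ?I R"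
    using ideal.helper_max_prime[OF J cring_axioms c] .
  show "J = (PIdl c) \<cdot> ?I"
    using sub unfolding cgenideal_ideal_prod[OF c I] by (auto simp: cgenideal_def m_comm c)
qed

end

lemma (in domain) cgenideal_ideal_prod_cancel:
  assumes c: "c \<in> carrier R" "c \<noteq> \<zero>" and A: "ideal A R" and B: "ideal B R"
    and sub: "(PIdl c) \<cdot> A \<subseteq> (PIdl c) \<cdot> B"
  shows "A \<subseteq> B"
proof
  fix x assume x: "x \<in> A"
  then have "c \<otimes> x \<in> (\<lambda>x. c \<otimes> x) ` B" using sub c A B by (auto simp: cgenideal_ideal_prod)
  then obtain y where y: "y \<in> B" "c \<otimes> x = c \<otimes> y" by auto
  then have "x = y" using c x ideal.Icarr[OF A] ideal.Icarr[OF B] by (simp add: m_lcancel)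
  with y show "x \<in> B" by simp
qed

context cring
begin

text \<open>Lists rather than sets, since factors may be repeated; \<^const>\<open>remove1\<close> then cancels a
  single occurrence.\<close>

definition ideal_list_prod :: "'a set list \<Rightarrow> 'a set" where
  "ideal_list_prod Ps = foldr (\<lambda>P J. P \<cdot> J) Ps (carrier R)"

lemma ideal_list_prod_simps [simp]:
  "ideal_list_prod [] = carrier R"
  "ideal_list_prod (P # Ps) = P \<cdot> ideal_list_prod Ps"
  by (simp_all add: ideal_list_prod_def)

lemma ideal_list_prod_ideal:
  "(\<And>P. P \<in> set Ps \<Longrightarrow> ideal P R) \<Longrightarrow> ideal (ideal_list_prod Ps) R"
  by (induct Ps) (auto intro: oneideal ideal_prod_is_ideal)

lemma ideal_list_prod_append:
  assumes "\<And>P. P \<in> set (Ps @ Qs) \<Longrightarrow> ideal P R"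
  shows "ideal_list_prod (Ps @ Qs) = ideal_list_prod Ps \<cdot> ideal_list_prod Qs"
  using assms
proof (induct Ps)
  case Nil
  then have "ideal (ideal_list_prod Qs) R" by (intro ideal_list_prod_ideal) auto
  then show ?case by (simp add: ideal_prod_commute[OF oneideal] ideal_prod_one)
next
  case (Cons P Ps)
  then have "ideal P R" "ideal (ideal_list_prod Ps) R" "ideal (ideal_list_prod Qs) R"
    by (auto intro: ideal_list_prod_ideal)
  with Cons show ?case by (simp add: ideal_prod_assoc)
qed

lemma ideal_list_prod_remove1:
  assumes "\<And>P. P \<in> set Ps \<Longrightarrow> ideal P R" "M \<in> set Ps"
  shows "ideal_list_prod Ps = M \<cdot> ideal_list_prod (remove1 M Ps)"
  using assms
proof (induct Ps)
  case (Cons P Ps)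
  show ?case
  proof (cases "P = M")
    case False
    then have "M \<in> set Ps" using Cons by auto
    moreover have "ideal (ideal_list_prod (remove1 M Ps)) R"
      using Cons(2) set_remove1_subset[of M Ps] by (intro ideal_list_prod_ideal) auto
    ultimately show ?thesis using Cons False
      by (simp add: ideal_prod_assoc[symmetric] ideal_prod_commute)
  qed simp
qed simp

lemma primeideal_ideal_list_prod:
  assumes "primeideal M R" "\<And>P. P \<in> set Ps \<Longrightarrow> ideal P R" "ideal_list_prod Ps \<subseteq> M"
  obtains P where "P \<in> set Ps" "P \<subseteq> M"
proof -
  have "\<exists>P\<in>set Ps. P \<subseteq> M"
    using assms(2,3)
  proof (induct Ps)
    case Nil
    then show ?case
      using primeideal.I_notcarr[OF assms(1)] additive_subgroup.a_subset[of M R]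
        primeideal.axioms(1)[OF assms(1)] ideal.axioms(1) by fastforce
  next
    case (Cons P Ps)
    have "ideal (ideal_list_prod Ps) R" using Cons(2) by (intro ideal_list_prod_ideal) auto
    then show ?case
      using Cons primeideal_divides_ideal_prod[OF assms(1), of P "ideal_list_prod Ps"] by auto
  qed
  then show thesis using that by blast
qed

end

text \<open>Noetherian induction. If \<open>I\<close> is proper and not prime, witnessed by
  \<open>a \<otimes> b \<in> I\<close>, then \<open>I + (a)\<close> and \<open>I + (b)\<close> are strictly larger than \<open>I\<close> while their
  product lies in \<open>I\<close>, so the two lists of primes found for them can be concatenated. The whole
  ring is the empty product.\<close>

lemma (in noetherian_domain) ideal_contains_prime_product:
  assumes "ideal I R" "I \<noteq> {\<zero>}"
  shows "\<exists>Ps. (\<forall>P\<in>set Ps. primeideal P R \<and> P \<noteq> {\<zero>}) \<and> ideal_list_prod Ps \<subseteq> I"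
  using assms
proof (induct I rule: wf_induct_rule[OF wf_ideal_psupset])
  case (1 I)
  interpret I: ideal I R by fact
  consider "I = carrier R" | "primeideal I R" | "I \<noteq> carrier R" "\<not> primeideal I R" by blast
  then show ?case
  proof cases
    case 1
    then show ?thesis by (intro exI[of _ "[]"]) auto
  next
    case 2
    then show ?thesis using "1.prems" by (intro exI[of _ "[I]"]) (auto simp: ideal_prod_one)
  next
    case 3
    then obtain a b where ab: "a \<in> carrier R" "b \<in> carrier R" "a \<otimes> b \<in> I" "a \<notin> I" "b \<notin> I"
      using primeidealI[OF 1(2) is_cring] by metis
    have *: "\<exists>Ps. (\<forall>P\<in>set Ps. primeideal P R \<and> P \<noteq> {\<zero>}) \<and> ideal_list_prod Ps \<subseteq> I <+> PIdl x"
      if x: "x \<in> carrier R" "x \<notin> I" for x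
    proof (rule 1(1))
      have id: "ideal (I <+> PIdl x) R" using "1.prems" x by (intro add_ideals cgenideal_ideal) auto
      have "\<zero> \<in> PIdl x"
        using cgenideal_ideal[OF x(1)] by (intro additive_subgroup.zero_closed ideal.axioms(1))
      then have "i \<oplus> \<zero> \<in> I <+> PIdl x" if "i \<in> I" for i :: 'a
        using that unfolding set_add_def' by blast
      then have "i \<in> I <+> PIdl x" if "i \<in> I" for i :: 'a
        using that I.Icarr[OF that] by simp
      moreover have "\<zero> \<oplus> x \<in> I <+> PIdl x"
        using I.zero_closed cgenideal_self[OF x(1)] unfolding set_add_def' by blast
      then have "x \<in> I <+> PIdl x"
        using x by simp
      ultimately have "I \<subseteq> I <+> PIdl x" "x \<in> I <+> PIdl x" by auto
      then show "(I <+> PIdl x, I) \<in> {(J, I). ideal I R \<and> ideal J R \<and> I \<subset> J}"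
        "I <+> PIdl x \<noteq> {\<zero>}" "ideal (I <+> PIdl x) R"
        using id x "1.prems" I.zero_closed by auto
    qed
    obtain Ps where Ps: "\<forall>P\<in>set Ps. primeideal P R \<and> P \<noteq> {\<zero>}" "ideal_list_prod Ps \<subseteq> I <+> PIdl a"
      using *[OF ab(1,4)] by auto
    obtain Qs where Qs: "\<forall>P\<in>set Qs. primeideal P R \<and> P \<noteq> {\<zero>}" "ideal_list_prod Qs \<subseteq> I <+> PIdl b"
      using *[OF ab(2,5)] by auto
    have "(I <+> PIdl a) \<cdot> (I <+> PIdl b) \<subseteq> I"
      unfolding ideal_prod_subset_iff[OF 1(2)]
    proof (intro ballI)
      fix u v :: 'a assume "u \<in> I <+> PIdl a" "v \<in> I <+> PIdl b"
      then obtain i j c d where ij: "i \<in> I" "j \<in> I" "c \<in> carrier R" "d \<in> carrier R"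
        and uv: "u = i \<oplus> c \<otimes> a" "v = j \<oplus> d \<otimes> b"
        by (auto simp: set_add_def' cgenideal_def)
      then have carr: "i \<in> carrier R" "j \<in> carrier R" "v \<in> carrier R"
        using ab I.Icarr by auto
      have "u \<otimes> v = i \<otimes> v \<oplus> ((c \<otimes> a) \<otimes> j \<oplus> (c \<otimes> a) \<otimes> (d \<otimes> b))"
        using ij ab carr by (simp add: uv(1) l_distr) (simp add: uv(2) r_distr)
      also have "(c \<otimes> a) \<otimes> (d \<otimes> b) = (c \<otimes> d) \<otimes> (a \<otimes> b)"
        using ij ab by (simp add: m_ac)
      also have "i \<otimes> v \<oplus> ((c \<otimes> a) \<otimes> j \<oplus> (c \<otimes> d) \<otimes> (a \<otimes> b)) \<in> I"
        using ij ab carr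
        by (intro I.a_closed[OF I.I_r_closed[OF ij(1)] I.a_closed[OF I.I_l_closed I.I_l_closed]])
          simp_all
      finally show "u \<otimes> v \<in> I" .
    qed
    then have "ideal_list_prod Ps \<cdot> ideal_list_prod Qs \<subseteq> I"
      using ideal_prod_mono[OF Ps(2) Qs(2)] by blast
    then have "ideal_list_prod (Ps @ Qs) \<subseteq> I"
      using Ps Qs by (subst ideal_list_prod_append) (auto dest: primeideal.axioms(1))
    then show ?thesis using Ps Qs by (intro exI[of _ "Ps @ Qs"]) auto
  qed
qed


section \<open>Maximal ideals of a Dedekind domain are invertible\<close>

context dedekind_domain
begin

text \<open>This is the only use of integral closure: if the fraction \<open>x = b/a\<close> maps \<open>M\<close> into itself,
  then \<open>x\<close> is integral, hence in the ring. Instead of the determinant trick on generators of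
  \<open>M\<close>, the proof follows the orbit \<open>m, x m, x\<^sup>2 m, \<dots>\<close> of one nonzero \<open>m \<in> M\<close>,
  which stays inside \<open>M\<close>. The ideals generated by its initial segments form an ascending chain,
  so some \<open>x\<^sup>n m\<close> is a combination of the earlier terms, and cancelling \<open>m\<close>
  leaves a monic equation for \<open>x\<close>.\<close>

lemma divides_if_mult_stabilizes_ideal:
  assumes a: "a \<in> carrier R" "a \<noteq> \<zero>" and b: "b \<in> carrier R"
    and M: "ideal M R" "M \<noteq> {\<zero>}"
    and stab: "\<And>m. m \<in> M \<Longrightarrow> \<exists>m'\<in>M. b \<otimes> m = a \<otimes> m'"
  shows "a divides b"
proof -
  interpret M: ideal M R by fact
  let ?F = "fraction_field R"
  let ?E = "frac_embed R"
  interpret F: field ?F by (rule field_fraction_field)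
  obtain m where m: "m \<in> M" "m \<noteq> \<zero>" using M(2) M.zero_closed by blast
  obtain f where f: "\<And>m. m \<in> M \<Longrightarrow> f m \<in> M" "\<And>m. m \<in> M \<Longrightarrow> b \<otimes> m = a \<otimes> f m"
    using stab by metis
  define y where "y n = (f ^^ n) m" for n
  have yM: "y n \<in> M" for n by (induct n) (auto simp: y_def m f)
  have yc: "y n \<in> carrier R" for n using yM M.Icarr by blast
  have yS: "b \<otimes> y n = a \<otimes> y (Suc n)" for n
    using f(2)[OF yM[of n]] by (simp add: y_def)
  \<comment> \<open>\<open>J n\<close> is the ideal generated by \<open>y 0, \<dots>, y (n - 1)\<close>. Adding one generator at a time makes
      the coefficient lists in \<open>comb\<close> below grow by one entry at the front.\<close>
  define J where "J n = rec_nat {\<zero>} (\<lambda>n K. K <+>\<^bsub>R\<^esub> PIdl (y n)) n" for n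
  have J0: "J 0 = {\<zero>}" and JS: "J (Suc n) = J n <+>\<^bsub>R\<^esub> PIdl (y n)" for n
    by (simp_all add: J_def)
  have JI: "ideal (J n) R" for n
    by (induct n) (auto simp: J0 JS zeroideal intro!: add_ideals cgenideal_ideal yc)
  have Jsub: "J n \<subseteq> J (Suc n)" for n
  proof
    fix z assume z: "z \<in> J n"
    then have "z \<oplus> \<zero> \<otimes> y n \<in> J (Suc n)"
      unfolding JS set_add_def' cgenideal_def by blast
    then show "z \<in> J (Suc n)" using yc ideal.Icarr[OF JI z] by simp
  qed
  have yJ: "y n \<in> J (Suc n)" for n
  proof -
    have "\<zero> \<oplus> y n \<in> J (Suc n)"
      unfolding JS set_add_def' using cgenideal_self[OF yc]
        additive_subgroup.zero_closed[OF ideal.axioms(1)[OF JI]] by blast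
    then show ?thesis using yc by simp
  qed
  obtain n where n: "J (Suc n) = J n"
  proof -
    have "\<exists>n. \<not> (J n \<subset> J (Suc n))"
    proof (rule ccontr)
      assume "\<nexists>n. \<not> (J n \<subset> J (Suc n))"
      then have "\<forall>n. (J (Suc n), J n) \<in> {(J, I). ideal I R \<and> ideal J R \<and> I \<subset> J}"
        using JI by simp
      with wf_ideal_psupset show False unfolding wf_iff_no_infinite_down_chain by blast
    qed
    then show thesis using that Jsub by blast
  qed
  define x where "x = frac_class R b a"
  have xc: "x \<in> carrier ?F" unfolding x_def using a b by (intro frac_class_closed) auto
  have Ec: "?E z \<in> carrier ?F" if "z \<in> carrier R" for z
    using ring_hom_closed[OF frac_embed_hom that] .
  have Eadd: "?E (z \<oplus> w) = ?E z \<oplus>\<^bsub>?F\<^esub> ?E w" if "z \<in> carrier R" "w \<in> carrier R" for z w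
    using ring_hom_add[OF frac_embed_hom that] .
  have Emult: "?E (z \<otimes> w) = ?E z \<otimes>\<^bsub>?F\<^esub> ?E w" if "z \<in> carrier R" "w \<in> carrier R" for z w
    using ring_hom_mult[OF frac_embed_hom that] .
  have E0: "?E \<zero> = \<zero>\<^bsub>?F\<^esub>" and E1: "?E \<one> = \<one>\<^bsub>?F\<^esub>"
    by (simp_all add: frac_embed_def frac_zero frac_one)
  have mc: "m \<in> carrier R" using m M.Icarr by blast
  have Em: "?E m \<in> carrier ?F" "?E m \<noteq> \<zero>\<^bsub>?F\<^esub>"
    using Ec[OF mc] inj_onD[OF inj_frac_embed, of m \<zero>] m(2) mc E0 by auto
  have Ey: "?E (y n) = x [^]\<^bsub>?F\<^esub> n \<otimes>\<^bsub>?F\<^esub> ?E m" for n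
  proof (induct n)
    case 0
    then show ?case using Em by (simp add: y_def)
  next
    case (Suc n)
    have "?E (y (Suc n)) = x \<otimes>\<^bsub>?F\<^esub> ?E (y n)"
      unfolding x_def frac_embed_def using a b yc yS[of n]
      by (simp add: frac_mult frac_class_eq_iff m_comm)
    then show ?case using Suc xc Em by (simp add: F.m_ac)
  qed
  have comb: "\<exists>p. length p = n \<and> set p \<subseteq> ?E ` carrier R \<and> ?E z = ring.eval ?F p x \<otimes>\<^bsub>?F\<^esub> ?E m"
    if "z \<in> J n" for z n
    using that
  proof (induct n arbitrary: z)
    case 0
    then show ?case using Em by (intro exI[of _ "[]"]) (auto simp: J0 E0)
  next
    case (Suc n)
    then obtain w c where w: "w \<in> J n" "c \<in> carrier R" "z = w \<oplus> c \<otimes> y n"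
      unfolding JS set_add_def' cgenideal_def by blast
    obtain p where p: "length p = n" "set p \<subseteq> ?E ` carrier R"
      "?E w = ring.eval ?F p x \<otimes>\<^bsub>?F\<^esub> ?E m"
      using Suc(1)[OF w(1)] by blast
    have pc: "ring.eval ?F p x \<in> carrier ?F"
      using p(2) Ec xc by (intro F.eval_in_carrier) auto
    have wc: "w \<in> carrier R" using ideal.Icarr[OF JI w(1)] .
    have "?E z = ?E w \<oplus>\<^bsub>?F\<^esub> ?E c \<otimes>\<^bsub>?F\<^esub> ?E (y n)"
      using w wc yc by (simp add: Eadd Emult)
    also have "\<dots> = ring.eval ?F (?E c # p) x \<otimes>\<^bsub>?F\<^esub> ?E m"
      using p pc xc Em Ec[OF w(2)] by (simp add: Ey F.l_distr F.m_assoc F.a_comm)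
    finally show ?case using p w by (intro exI[of _ "?E c # p"]) auto
  qed
  have "y n \<in> J n" using yJ n by auto
  \<comment> \<open>Passing to the negative puts the relation into the form "monic polynomial at \<open>x\<close> is zero".\<close>
  then have "\<ominus> y n \<in> J n"
    using additive_subgroup.a_inv_closed[OF ideal.axioms(1)[OF JI]] by blast
  from comb[OF this] obtain p where p: "length p = n" "set p \<subseteq> ?E ` carrier R"
    "?E (\<ominus> y n) = ring.eval ?F p x \<otimes>\<^bsub>?F\<^esub> ?E m" by blast
  have pc: "ring.eval ?F p x \<in> carrier ?F"
    using p(2) Ec xc by (intro F.eval_in_carrier) auto
  have "?E (y n) \<oplus>\<^bsub>?F\<^esub> ?E (\<ominus> y n) = \<zero>\<^bsub>?F\<^esub>"
    using yc[of n] by (simp add: Eadd[symmetric] r_neg E0)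
  then have "ring.eval ?F (\<one>\<^bsub>?F\<^esub> # p) x \<otimes>\<^bsub>?F\<^esub> ?E m = \<zero>\<^bsub>?F\<^esub>"
    using p pc xc Em by (simp add: Ey F.l_distr)
  then have "ring.eval ?F (\<one>\<^bsub>?F\<^esub> # p) x = \<zero>\<^bsub>?F\<^esub>"
    using Em pc xc p(1) F.integral_iff[of "ring.eval ?F (\<one>\<^bsub>?F\<^esub> # p) x" "?E m"] by simp
  then have "integral_over ?F (?E ` carrier R) x"
    unfolding integral_over_def polynomial_def using p E1[symmetric] F.one_not_zero
    by (intro exI[of _ "\<one>\<^bsub>?F\<^esub> # p"]) auto
  then have "x \<in> ?E ` carrier R"
    using integrally_closed xc unfolding integrally_closed_def by blast
  then obtain d where d: "d \<in> carrier R" "x = ?E d" by auto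
  then have "b = a \<otimes> d"
    using a b by (simp add: x_def frac_embed_def frac_class_eq_iff m_comm)
  with d show ?thesis unfolding factor_def by blast
qed

text \<open>A prime containing a product contains a factor; as nonzero primes are maximal, it is that
  factor.\<close>

lemma maximalideal_above_prime_product:
  assumes M: "maximalideal M R"
    and Ps: "\<And>P. P \<in> set Ps \<Longrightarrow> primeideal P R \<and> P \<noteq> {\<zero>}" and sub: "ideal_list_prod Ps \<subseteq> M"
  shows "M \<in> set Ps"
proof -
  interpret M: maximalideal M R by fact
  have "ideal P R" if "P \<in> set Ps" for P using Ps[OF that] primeideal.axioms(1) by blast
  then obtain P where P: "P \<in> set Ps" "P \<subseteq> M"
    using primeideal_ideal_list_prod[OF maximalideal_prime[OF M] _ sub] by blast
  have "maximalideal P R" using nonzero_prime_imp_maximal Ps[OF P(1)] by blast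
  then have "M = P"
    using maximalideal.I_maximal[OF _ M.is_ideal P(2)] M.I_notcarr M.Icarr by blast
  with P show ?thesis by simp
qed

text \<open>Take \<open>0 \<noteq> a \<in> M\<close> and a shortest product of nonzero primes inside \<open>(a)\<close>. One of its factors
  is \<open>M\<close>, and by minimality the product of the others contains some \<open>b \<notin> (a)\<close>; still
  \<open>b M \<subseteq> (a)\<close>. Put \<open>N = (a, b)\<close>. Then \<open>M N \<subseteq> (a)\<close>, so \<open>M N = a K\<close> with
  \<open>M \<subseteq> K\<close>. By maximality \<open>K\<close> is \<open>M\<close> or the whole ring, and \<open>K = M\<close> would mean that
  \<open>b/a\<close> stabilizes \<open>M\<close>, forcing \<open>b \<in> (a)\<close>.\<close>

lemma maximalideal_invertible:
  assumes M: "maximalideal M R" "M \<noteq> {\<zero>}"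
  obtains N c where "ideal N R" "c \<in> carrier R" "c \<noteq> \<zero>" "M \<cdot> N = PIdl c"
proof -
  interpret M: maximalideal M R by fact
  have Mi: "ideal M R" by (rule M.is_ideal)
  obtain a where a: "a \<in> M" "a \<noteq> \<zero>" using M(2) M.zero_closed by blast
  have ac: "a \<in> carrier R" using a M.Icarr by blast
  let ?P = "\<lambda>Ps. (\<forall>P\<in>set Ps. primeideal P R \<and> P \<noteq> {\<zero>}) \<and> ideal_list_prod Ps \<subseteq> PIdl a"
  have "PIdl a \<noteq> {\<zero>}" using cgenideal_self[OF ac] a by auto
  then have "\<exists>Ps. ?P Ps" by (intro ideal_contains_prime_product cgenideal_ideal ac)
  then have "\<exists>Ps. ?P Ps \<and> (\<forall>Qs. ?P Qs \<longrightarrow> length Ps \<le> length Qs)"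
    by (elim exE) (rule ex_has_least_nat)
  then obtain Ps where Ps: "?P Ps" and min: "\<And>Qs. ?P Qs \<Longrightarrow> length Ps \<le> length Qs"
    by (elim exE conjE) (rule that, blast+)
  have Pi: "ideal P R" if "P \<in> set Ps" for P using Ps that primeideal.axioms(1) by blast
  have "ideal_list_prod Ps \<subseteq> M" using Ps cgenideal_minimal[OF Mi a(1)] by blast
  then have MPs: "M \<in> set Ps"
    using Ps by (intro maximalideal_above_prime_product[OF M(1)]) auto
  let ?Q = "remove1 M Ps"
  have Q: "set ?Q \<subseteq> set Ps" by (rule set_remove1_subset)
  have "length ?Q < length Ps" using MPs length_pos_if_in_set[OF MPs] by (simp add: length_remove1)
  then have "\<not> ideal_list_prod ?Q \<subseteq> PIdl a" using min[of ?Q] Ps Q by auto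
  then obtain b where b: "b \<in> ideal_list_prod ?Q" "b \<notin> PIdl a" by blast
  have Qi: "ideal (ideal_list_prod ?Q) R" using Q Pi by (intro ideal_list_prod_ideal) auto
  have bc: "b \<in> carrier R" using b ideal.Icarr[OF Qi] by blast
  have split: "ideal_list_prod Ps = M \<cdot> ideal_list_prod ?Q"
    by (rule ideal_list_prod_remove1) (use Pi MPs in auto)
  have bM: "b \<otimes> m \<in> PIdl a" if "m \<in> M" for m
  proof -
    have "m \<otimes> b \<in> ideal_list_prod Ps"
      unfolding split using that b by (intro ideal_prod.prod)
    then show ?thesis using Ps m_comm[OF bc M.Icarr[OF that]] by auto
  qed
  define N where "N = PIdl a <+>\<^bsub>R\<^esub> PIdl b"
  have Ni: "ideal N R" unfolding N_def by (intro add_ideals cgenideal_ideal ac bc)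
  have MN: "ideal (M \<cdot> N) R" by (rule ideal_prod_is_ideal[OF Mi Ni])
  have "M \<cdot> N \<subseteq> PIdl a"
    unfolding ideal_prod_subset_iff[OF cgenideal_ideal[OF ac]]
  proof (intro ballI)
    fix m v assume m: "m \<in> M" and "v \<in> N"
    then obtain c d where cd: "c \<in> carrier R" "d \<in> carrier R" "v = c \<otimes> a \<oplus> d \<otimes> b"
      by (auto simp: N_def set_add_def' cgenideal_def)
    interpret A: ideal "PIdl a" R by (rule cgenideal_ideal[OF ac])
    have mc: "m \<in> carrier R" using m M.Icarr by blast
    have "m \<otimes> v = (m \<otimes> c) \<otimes> a \<oplus> d \<otimes> (b \<otimes> m)"
      using cd mc ac bc by (simp add: r_distr m_ac)
    also have "\<dots> \<in> PIdl a"
      using cd mc by (intro A.a_closed A.I_l_closed cgenideal_self[OF ac] bM[OF m]) auto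
    finally show "m \<otimes> v \<in> PIdl a" .
  qed
  then obtain K where K: "ideal K R" "M \<cdot> N = (PIdl a) \<cdot> K"
    by (rule ideal_subset_cgenideal_factor[OF ac MN])
  have aN: "a \<in> N" and bN: "b \<in> N"
  proof -
    have "\<one> \<otimes> a \<oplus> \<zero> \<otimes> b \<in> N" "\<zero> \<otimes> a \<oplus> \<one> \<otimes> b \<in> N"
      unfolding N_def set_add_def' cgenideal_def by blast+
    then show "a \<in> N" "b \<in> N" using ac bc by auto
  qed
  have MK: "M \<subseteq> K"
  proof (rule cgenideal_ideal_prod_cancel[OF ac a(2) Mi K(1)])
    have "PIdl a \<subseteq> N" by (rule cgenideal_minimal[OF Ni aN])
    then have "(PIdl a) \<cdot> M \<subseteq> N \<cdot> M" by (rule ideal_prod_mono) simp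
    then show "(PIdl a) \<cdot> M \<subseteq> (PIdl a) \<cdot> K" using K(2) ideal_prod_commute[OF Mi Ni] by simp
  qed
  have "K \<noteq> M"
  proof
    assume "K = M"
    have "\<exists>m'\<in>M. b \<otimes> m = a \<otimes> m'" if m: "m \<in> M" for m
    proof -
      have "m \<otimes> b \<in> (PIdl a) \<cdot> M"
        unfolding K(2)[unfolded \<open>K = M\<close>, symmetric] using m bN by (intro ideal_prod.prod)
      then show ?thesis
        unfolding cgenideal_ideal_prod[OF ac Mi] using m_comm[OF bc M.Icarr[OF m]] by auto
    qed
    then have "a divides b"
      by (rule divides_if_mult_stabilizes_ideal[OF ac a(2) bc Mi M(2)])
    then have "b \<in> PIdl a" using ac unfolding factor_def cgenideal_def by (auto intro: m_comm)
    with b show False by blast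
  qed
  then have "K = carrier R"
    using M.I_maximal[OF K(1) MK] ideal.Icarr[OF K(1)] by blast
  then have "M \<cdot> N = PIdl a" using K(2) ideal_prod_one[OF cgenideal_ideal[OF ac]] by simp
  then show thesis using that Ni ac a by blast
qed

lemma maximalideal_prod_cancel:
  assumes M: "maximalideal M R" "M \<noteq> {\<zero>}" and A: "ideal A R" and B: "ideal B R"
    and sub: "M \<cdot> A \<subseteq> M \<cdot> B"
  shows "A \<subseteq> B"
proof -
  obtain N c where N: "ideal N R" "c \<in> carrier R" "c \<noteq> \<zero>" "M \<cdot> N = PIdl c"
    by (rule maximalideal_invertible[OF M])
  have Mi: "ideal M R" using M(1) maximalideal.axioms(1) by blast
  have "N \<cdot> (M \<cdot> A) \<subseteq> N \<cdot> (M \<cdot> B)" by (rule ideal_prod_mono[OF subset_refl sub])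
  then have "(PIdl c) \<cdot> A \<subseteq> (PIdl c) \<cdot> B"
    using N Mi A B by (simp add: ideal_prod_assoc[symmetric] ideal_prod_commute[of N M])
  then show ?thesis by (rule cgenideal_ideal_prod_cancel[OF N(2,3) A B])
qed

text \<open>The cofactor is \<open>M\<^sup>-\<^sup>1 I = c\<^sup>-\<^sup>1 (I N)\<close>, and the division by \<open>c\<close> stays in the ring
  because \<open>I N \<subseteq> M N = (c)\<close>.\<close>

lemma maximalideal_contains_imp_factor:
  assumes M: "maximalideal M R" "M \<noteq> {\<zero>}" and I: "ideal I R" "I \<subseteq> M"
  obtains J where "ideal J R" "I = M \<cdot> J"
proof -
  obtain N c where N: "ideal N R" "c \<in> carrier R" "c \<noteq> \<zero>" "M \<cdot> N = PIdl c"
    by (rule maximalideal_invertible[OF M])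
  have Mi: "ideal M R" using M(1) maximalideal.axioms(1) by blast
  have ci: "ideal (PIdl c) R" by (rule cgenideal_ideal[OF N(2)])
  have IN: "ideal (I \<cdot> N) R" by (rule ideal_prod_is_ideal[OF I(1) N(1)])
  have "I \<cdot> N \<subseteq> PIdl c" using ideal_prod_mono[OF I(2), of N N] N(4) by simp
  then obtain J where J: "ideal J R" "I \<cdot> N = (PIdl c) \<cdot> J"
    by (rule ideal_subset_cgenideal_factor[OF N(2) IN])
  have MJ: "ideal (M \<cdot> J) R" by (rule ideal_prod_is_ideal[OF Mi J(1)])
  have "(PIdl c) \<cdot> I = M \<cdot> (I \<cdot> N)"
    using N(1) Mi I(1) by (simp add: N(4)[symmetric] ideal_prod_assoc ideal_prod_commute[of N I])
  also have "\<dots> = (M \<cdot> (PIdl c)) \<cdot> J"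
    using Mi ci J by (simp add: ideal_prod_assoc)
  also have "\<dots> = (PIdl c) \<cdot> (M \<cdot> J)"
    using Mi ci J(1) by (simp add: ideal_prod_assoc ideal_prod_commute[of M "PIdl c"])
  finally have "(PIdl c) \<cdot> I = (PIdl c) \<cdot> (M \<cdot> J)" .
  then have "I = M \<cdot> J"
    using cgenideal_ideal_prod_cancel[OF N(2,3) I(1) MJ]
      cgenideal_ideal_prod_cancel[OF N(2,3) MJ I(1)] by auto
  then show thesis using that J by blast
qed

section \<open>A nonzero element lies in only finitely many ideals\<close>

text \<open>Induction on the length of the list. A proper ideal \<open>I\<close> above the product lies in a maximal
  ideal \<open>M\<close>, which must occur in the list. Then \<open>I = M J\<close>, and cancelling the invertible \<open>M\<close>
  shows that \<open>J\<close> lies above the product of the remaining primes. So there are finitely many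
  choices for \<open>M\<close> and, by induction, for \<open>J\<close>.\<close>

lemma finite_ideals_above_prime_product:
  assumes "\<And>P. P \<in> set Ps \<Longrightarrow> primeideal P R \<and> P \<noteq> {\<zero>}"
  shows "finite {I. ideal I R \<and> ideal_list_prod Ps \<subseteq> I}"
  using assms
proof (induct "length Ps" arbitrary: Ps rule: less_induct)
  case less
  let ?A = "\<lambda>Ps. {I. ideal I R \<and> ideal_list_prod Ps \<subseteq> I}"
  have Pi: "ideal P R" if "P \<in> set Ps" for P using less.prems that primeideal.axioms(1) by blast
  have sub: "?A Ps \<subseteq> insert (carrier R) (\<Union>M\<in>set Ps. (\<lambda>J. M \<cdot> J) ` ?A (remove1 M Ps))"
  proof
    fix I assume "I \<in> ?A Ps"
    then have I: "ideal I R" "ideal_list_prod Ps \<subseteq> I" by auto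
    show "I \<in> insert (carrier R) (\<Union>M\<in>set Ps. (\<lambda>J. M \<cdot> J) ` ?A (remove1 M Ps))"
    proof (cases "I = carrier R")
      case False
      then obtain M where M: "maximalideal M R" "I \<subseteq> M"
        using ideal_subset_maximalideal I(1) by blast
      have "M \<in> set Ps"
        using less.prems I M by (intro maximalideal_above_prime_product[OF M(1)]) auto
      then have MPs: "M \<in> set Ps" "M \<noteq> {\<zero>}" using less.prems by auto
      obtain J where J: "ideal J R" "I = M \<cdot> J"
        by (rule maximalideal_contains_imp_factor[OF M(1) MPs(2) I(1) M(2)])
      have split: "ideal_list_prod Ps = M \<cdot> ideal_list_prod (remove1 M Ps)"
        by (rule ideal_list_prod_remove1) (use Pi MPs in auto)
      have "ideal (ideal_list_prod (remove1 M Ps)) R"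
        using Pi set_remove1_subset[of M Ps] by (intro ideal_list_prod_ideal) auto
      moreover have "M \<cdot> ideal_list_prod (remove1 M Ps) \<subseteq> M \<cdot> J"
        using I(2) unfolding J(2) split .
      ultimately have "ideal_list_prod (remove1 M Ps) \<subseteq> J"
        using maximalideal_prod_cancel[OF M(1) MPs(2) _ J(1)] by blast
      then show ?thesis using J MPs by auto
    qed simp
  qed
  have "finite (?A (remove1 M Ps))" if "M \<in> set Ps" for M
  proof (rule less.hyps)
    show "length (remove1 M Ps) < length Ps"
      using that length_pos_if_in_set[OF that] by (simp add: length_remove1)
    show "primeideal P R \<and> P \<noteq> {\<zero>}" if "P \<in> set (remove1 M Ps)" for P
      using that set_remove1_subset[of M Ps] less.prems by blast
  qed
  then show ?case by (intro finite_subset[OF sub]) auto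
qed

lemma finite_ideals_containing:
  assumes "d \<in> carrier R" "d \<noteq> \<zero>"
  shows "finite {I. ideal I R \<and> d \<in> I}"
proof -
  have "PIdl d \<noteq> {\<zero>}" using cgenideal_self[OF assms(1)] assms by auto
  then obtain Ps where Ps: "\<forall>P\<in>set Ps. primeideal P R \<and> P \<noteq> {\<zero>}" "ideal_list_prod Ps \<subseteq> PIdl d"
    using ideal_contains_prime_product[OF cgenideal_ideal[OF assms(1)]] by blast
  have "{I. ideal I R \<and> d \<in> I} \<subseteq> {I. ideal I R \<and> ideal_list_prod Ps \<subseteq> I}"
    using Ps(2) cgenideal_minimal by blast
  then show ?thesis
    by (rule finite_subset) (use Ps(1) in \<open>intro finite_ideals_above_prime_product; blast\<close>)
qed

end


section \<open>Vanishing of the exponents\<close>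

lemma removed_sum_cong:
  assumes "\<And>i. i < n \<Longrightarrow> a i = a' i"
  shows "removed_sum R I h r a n s = removed_sum R I h r a' n s"
proof -
  have "(\<Sum>i\<in>A. min h (ideal_val R I (s \<ominus>\<^bsub>R\<^esub> a i))) = (\<Sum>i\<in>A. min h (ideal_val R I (s \<ominus>\<^bsub>R\<^esub> a' i)))"
    if "A \<subseteq> {..<n}" for A
    using that assms by (intro sum.cong) auto
  then have "{\<Sum>i\<in>A. min h (ideal_val R I (s \<ominus>\<^bsub>R\<^esub> a i)) | A. A \<subseteq> {..<n} \<and> card A = n - r} =
    {\<Sum>i\<in>A. min h (ideal_val R I (s \<ominus>\<^bsub>R\<^esub> a' i)) | A. A \<subseteq> {..<n} \<and> card A = n - r}"
    by (intro Collect_cong ex_cong1) auto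
  then show ?thesis unfolding removed_sum_def by simp
qed

text \<open>This gives meaning to the choice of an ordering in \<^const>\<open>alpha\<close>. The sum to be minimized at a
  position depends only on earlier terms and takes values in a well-order, so the terms can be
  chosen one after another.\<close>

lemma removed_ordering_exists:
  fixes R :: "('a, 'm) ring_scheme"
  assumes "S \<noteq> {}"
  shows "\<exists>a. removed_ordering R S I h r a"
proof -
  let ?P = "\<lambda>a n v. v \<in> S \<and> (\<forall>s\<in>S. removed_sum R I h r a n v \<le> removed_sum R I h r a n s)"
  have "\<exists>a. \<forall>n. ?P a n (a n)"
  proof (rule dependent_wellorder_choice)
    fix v :: 'a and a a' :: "nat \<Rightarrow> 'a" and n :: nat
    assume *: "\<And>i. i < n \<Longrightarrow> a i = a' i"
    show "?P a n v = ?P a' n v" by (simp add: removed_sum_cong[OF *])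
  next
    fix n :: nat and a :: "nat \<Rightarrow> 'a"
    let ?V = "removed_sum R I h r a n ` S"
    have "(LEAST e. e \<in> ?V) \<in> ?V" using assms by (auto intro: LeastI_ex)
    then obtain v where v: "v \<in> S" "removed_sum R I h r a n v = (LEAST e. e \<in> ?V)" by auto
    have "removed_sum R I h r a n v \<le> removed_sum R I h r a n s" if "s \<in> S" for s
      unfolding v(2) using that by (intro Least_le) auto
    with v(1) show "\<exists>v. ?P a n v" by blast
  qed
  then show ?thesis unfolding removed_ordering_def by blast
qed

text \<open>The premise \<open>n > r\<close> covers the initial positions, where the sum is empty whatever the valuations are.\<close>

lemma removed_sum_eq_0:
  assumes "\<And>i. i < n \<Longrightarrow> n > r \<Longrightarrow> ideal_val R I (s \<ominus>\<^bsub>R\<^esub> a i) = 0"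
  shows "removed_sum R I h r a n s = 0"
proof -
  let ?f = "\<lambda>A. \<Sum>i\<in>A. min h (ideal_val R I (s \<ominus>\<^bsub>R\<^esub> a i))"
  let ?V = "{?f A | A. A \<subseteq> {..<n} \<and> card A = n - r}"
  have "?V = ?f ` {A. A \<subseteq> {..<n} \<and> card A = n - r}" by auto
  then have fin: "finite ?V" by simp
  have "?f {..<n - r} = 0"
    using assms by (intro sum.neutral) (auto simp: min_def)
  then have "0 \<in> ?V" by (intro CollectI exI[of _ "{..<n - r}"]) auto
  then have "Min ?V \<le> 0" using fin by (rule Min_le[rotated])
  then show ?thesis unfolding removed_sum_def by simp
qed

context cring
begin

lemma ideal_val_eq_0:
  assumes I: "ideal I R" and a: "a \<in> carrier R" "a \<notin> I"
  shows "ideal_val R I a = 0"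
proof -
  interpret Is: comm_monoid "ideals_set R" by (rule ideals_set_is_comm_monoid)
  have carr: "carrier (ideals_set R) = {I. ideal I R}"
    and mult: "monoid.mult (ideals_set R) = ideal_prod R"
    by (simp_all add: ideals_set_def)
  have "k = 0" if "PIdl a \<subseteq> I [^]\<^bsub>ideals_set R\<^esub> k" for k :: nat
  proof (cases k)
    case (Suc l)
    have "ideal (I [^]\<^bsub>ideals_set R\<^esub> l) R" using Is.nat_pow_closed[of I l] I by (simp add: carr)
    then have "I [^]\<^bsub>ideals_set R\<^esub> k \<subseteq> I"
      using ideal_prod_inter[OF _ I] unfolding Suc by (auto simp: mult)
    then show ?thesis using that a cgenideal_self[OF a(1)] by blast
  qed
  then have "ideal_val R I a \<le> 0"
    unfolding ideal_val_def by (intro Sup_least) (auto simp: zero_enat_def)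
  then show ?thesis by simp
qed

text \<open>If \<open>S\<close> meets more than \<open>k\<close> residue classes modulo \<open>I\<close>, then by the pigeonhole principle some
  \<open>s \<in> S\<close> is incongruent to each of \<open>a\<^sub>0, \<dots>, a\<^sub>k\<^sub>-\<^sub>1\<close>. All summands for \<open>s\<close>
  vanish, and for \<open>k > r\<close> the element \<open>a\<^sub>k\<close> does at least as well. For \<open>k \<le> r\<close> the sum is
  empty.\<close>

lemma alpha_eq_0:
  assumes S: "S \<subseteq> carrier R" and I: "ideal I R"
    and U: "finite U" "U \<subseteq> S" "k < card U"
    and sep: "\<And>x y. x \<in> U \<Longrightarrow> y \<in> U \<Longrightarrow> x \<ominus> y \<in> I \<Longrightarrow> x = y"
  shows "alpha R S I h r k = 0"
proof -
  interpret I: ideal I R by fact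
  define a where "a = (SOME a. removed_ordering R S I h r a)"
  have "S \<noteq> {}" using U by auto
  then have a: "removed_ordering R S I h r a"
    unfolding a_def by (rule someI_ex[OF removed_ordering_exists])
  then have ac: "a i \<in> carrier R" for i using S unfolding removed_ordering_def by blast
  have "removed_sum R I h r a k (a k) = 0"
  proof (cases "k > r")
    case True
    have "\<exists>s\<in>U. \<forall>i<k. s \<ominus> a i \<notin> I"
    proof (rule ccontr)
      assume "\<not> (\<exists>s\<in>U. \<forall>i<k. s \<ominus> a i \<notin> I)"
      then have "\<forall>s\<in>U. \<exists>i. i < k \<and> s \<ominus> a i \<in> I" by blast
      then obtain f where f: "\<And>s. s \<in> U \<Longrightarrow> f s < k \<and> s \<ominus> a (f s) \<in> I" by metis
      have "card (f ` U) \<le> card {..<k}" using f by (intro card_mono) auto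
      then have "\<not> inj_on f U" using U(3) card_image by fastforce
      then obtain s t where st: "s \<in> U" "t \<in> U" "f s = f t" "s \<noteq> t" unfolding inj_on_def by blast
      then have "s \<in> carrier R" "t \<in> carrier R" using U S by auto
      then have "s \<ominus> t = (s \<ominus> a (f s)) \<oplus> \<ominus> (t \<ominus> a (f s))"
        using ac[of "f s"] by (simp add: minus_eq minus_add a_ac r_neg r_neg1 r_neg2)
      also have "\<dots> \<in> I"
        using f[OF st(1)] f[OF st(2)] st(3) by (auto intro: I.a_closed I.a_inv_closed)
      finally show False using sep st by blast
    qed
    then obtain s where s: "s \<in> U" "\<And>i. i < k \<Longrightarrow> s \<ominus> a i \<notin> I" by blast
    have sc: "s \<in> S" "s \<in> carrier R" using s U S by auto
    have "removed_sum R I h r a k s = 0"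
      using s(2) sc ac by (intro removed_sum_eq_0 ideal_val_eq_0 I) auto
    moreover have "removed_sum R I h r a k (a k) \<le> removed_sum R I h r a k s"
      using a True sc(1) unfolding removed_ordering_def by blast
    ultimately show ?thesis by simp
  next
    case False
    then show ?thesis by (intro removed_sum_eq_0) auto
  qed
  then show ?thesis unfolding alpha_def alpha_seq_def a_def .
qed

lemma ideal_epow_ideal: "ideal I R \<Longrightarrow> ideal (ideal_epow R I e) R"
proof -
  interpret Is: comm_monoid "ideals_set R" by (rule ideals_set_is_comm_monoid)
  assume "ideal I R"
  then have "ideal (I [^]\<^bsub>ideals_set R\<^esub> k) R" for k :: nat
    using Is.nat_pow_closed[of I k] by (simp add: ideals_set_def)
  then show ?thesis unfolding ideal_epow_def by (simp add: oneideal zeroideal split: enat.split)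
qed

end

lemma ideal_epow_0 [simp]: "ideal_epow R I 0 = carrier R"
  by (simp add: ideal_epow_def zero_enat_def ideals_set_def nat_pow_def)


section \<open>Divisibility of generalized factorial ideals\<close>

lemma (in dedekind_domain) finite_nonunit_factors:
  assumes S: "S \<subseteq> carrier R" and k: "infinite S \<or> k < card S"
  shows "finite {I. ideal I R \<and> ideal_epow R I (alpha R S I h r k) \<noteq> carrier R}"
proof -
  obtain U where U: "finite U" "U \<subseteq> S" "card U = Suc k"
  proof (cases "finite S")
    case True
    then show thesis using k obtain_subset_with_card_n[of "Suc k" S] that
      by (metis Suc_leI finite_subset)
  next
    case False
    then show thesis using infinite_arbitrarily_large[of S "Suc k"] that by blast
  qed
  let ?d = "{x \<ominus> y | x y. x \<in> U \<and> y \<in> U \<and> x \<noteq> y}"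
  have sub: "{I. ideal I R \<and> ideal_epow R I (alpha R S I h r k) \<noteq> carrier R}
    \<subseteq> (\<Union>d\<in>?d. {I. ideal I R \<and> d \<in> I})"
  proof clarify
    fix I assume I: "ideal I R" and ne: "ideal_epow R I (alpha R S I h r k) \<noteq> carrier R"
    show "I \<in> (\<Union>d\<in>?d. {I. ideal I R \<and> d \<in> I})"
    proof (rule ccontr)
      assume "I \<notin> (\<Union>d\<in>?d. {I. ideal I R \<and> d \<in> I})"
      then have "x = y" if "x \<in> U" "y \<in> U" "x \<ominus> y \<in> I" for x y using I that by blast
      then have "alpha R S I h r k = 0" using alpha_eq_0[OF S I U(1,2)] U(3) by auto
      with ne show False by simp
    qed
  qed
  have "?d \<subseteq> (\<lambda>(x, y). x \<ominus> y) ` (U \<times> U)" by auto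
  then have "finite ?d" using U(1) finite_subset by blast
  moreover have "finite {I. ideal I R \<and> d \<in> I}" if d: "d \<in> ?d" for d
  proof -
    obtain x y where xy: "x \<in> U" "y \<in> U" "x \<noteq> y" "d = x \<ominus> y" using d by blast
    have "x \<in> carrier R" "y \<in> carrier R" using xy U(2) S by auto
    then show ?thesis using xy by (intro finite_ideals_containing) (auto simp: r_right_minus_eq)
  qed
  ultimately show ?thesis by (intro finite_subset[OF sub]) blast
qed

theorem proposition3p9:
  fixes D :: "('a, 'm) ring_scheme"
    and S :: "'a set"
    and h :: enat
    and r k :: nat
    and T1 T2 :: "'a set set"
  assumes "dedekind_domain D"
    and "S \<subseteq> carrier D" and "S \<noteq> {}"
    and "T1 \<subseteq> T2" and "T2 \<subseteq> {I. ideal I D}"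
    and "infinite S \<or> k < card S"
  shows "factorial_ideal D S T1 h r k divides\<^bsub>ideals_set D\<^esub> factorial_ideal D S T2 h r k \<and>
         factorial_ideal D S T2 h r k \<subseteq> factorial_ideal D S T1 h r k"
proof -
  interpret dedekind_domain D by fact
  interpret Is: comm_monoid "ideals_set D" by (rule ideals_set_is_comm_monoid)
  have carr: "carrier (ideals_set D) = {I. ideal I D}"
    and mult: "monoid.mult (ideals_set D) = ideal_prod D"
    by (simp_all add: ideals_set_def)
  define e where "e I = ideal_epow D I (alpha D S I h r k)" for I
  define A where "A T = {I \<in> T. e I \<noteq> carrier D}" for T
  have fac: "factorial_ideal D S T h r k = finprod (ideals_set D) e (A T)" for T
    unfolding factorial_ideal_def A_def e_def ..
  have "A T2 \<subseteq> {I. ideal I D \<and> ideal_epow D I (alpha D S I h r k) \<noteq> carrier D}"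
    using assms(5) unfolding A_def e_def by blast
  then have fin: "finite (A T2)"
    using finite_nonunit_factors[OF assms(2,6)] finite_subset by blast
  have A12: "A T1 \<subseteq> A T2" using assms(4) unfolding A_def by blast
  have e: "e \<in> A T2 \<rightarrow> carrier (ideals_set D)"
    using assms(5) unfolding A_def e_def carr by (auto intro: ideal_epow_ideal)
  then have e1: "e \<in> A T1 \<rightarrow> carrier (ideals_set D)"
    and e2: "e \<in> A T2 - A T1 \<rightarrow> carrier (ideals_set D)" using A12 by auto
  let ?Q = "finprod (ideals_set D) e (A T2 - A T1)"
  have Q: "?Q \<in> carrier (ideals_set D)" using e2 by (rule Is.finprod_closed)
  have F1: "factorial_ideal D S T1 h r k \<in> carrier (ideals_set D)"
    unfolding fac using e1 by (rule Is.finprod_closed)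
  have "finprod (ideals_set D) e (A T1 \<union> (A T2 - A T1)) =
    finprod (ideals_set D) e (A T1) \<otimes>\<^bsub>ideals_set D\<^esub> ?Q"
    using fin finite_subset[OF A12 fin] e1 e2 by (intro Is.finprod_Un_disjoint) auto
  moreover have "A T1 \<union> (A T2 - A T1) = A T2" using A12 by blast
  ultimately have split: "factorial_ideal D S T2 h r k =
    factorial_ideal D S T1 h r k \<otimes>\<^bsub>ideals_set D\<^esub> ?Q"
    unfolding fac by simp
  have "factorial_ideal D S T2 h r k \<subseteq> factorial_ideal D S T1 h r k"
    using ideal_prod_inter[of "factorial_ideal D S T1 h r k" ?Q] F1 Q
    unfolding split mult carr by blast
  then show ?thesis using split Q unfolding factor_def by blast
qed

end
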